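(* Let $M$ be a compact topological manifold (possibly with boundary), endowed with a metric $d$ compatible with its topology. Then the set of maps $f\in C(M)$ which exhibit distributional chaos of type 1 (DC1) is dense in $C(M)$ with respect to the metric $d_{C^0}(f,g)=\sup_{x\in M}d(f(x),g(x))$.
   Context: $C(M)$ denotes the space of continuous self-maps of $M$. For a continuous map $f:X\to X$ of a compact metric space $(X,d)$, a pair $(x,y)\in X^2$ is a DC1-pair for $f$ if $\limsup_{n\to\infty}\frac1n|\{0\le i\le n-1: d(f^i(x),f^i(y))<\delta\}|=1$ for every $\delta>0$, and $\limsup_{n\to\infty}\frac1n|\{0\le i\le n-1: d(f^i(x),f^i(y))>\delta_0\}|=1$ for some $\delta_0>0$. The map $f$ exhibits DC1 if there is an uncountable set $S\subset X$ such that every pair $(x,y)$ with $x,y\in S$, $x\ne y$, is a DC1-pair for $f$.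
   Formalization: The manifold M is taken to be nonempty and of dimension at least 1; for an empty or zero-dimensional (finite) compact M the claim fails, since no uncountable scrambled set can exist. *)

theory Defs
  imports "HOL-Analysis.Analysis" "HOL-Library.Liminf_Limsup"
begin

definition half_space :: "'n::finite \<Rightarrow> (real^'n) set" where
  "half_space k = {y. 0 \<le> y $ k}"

definition topological_manifold_with_boundary ::
  "'n::finite itself \<Rightarrow> 'a::metric_space set \<Rightarrow> bool" where
  "topological_manifold_with_boundary _ M \<longleftrightarrow>
     (\<exists>k::'n. \<forall>x\<in>M. \<exists>U V. openin (top_of_set M) U \<and> x \<in> U \<and>
        openin (top_of_set (half_space k)) V \<and> U homeomorphic V)"

definition Cmaps :: "'a::topological_space set \<Rightarrow> ('a \<Rightarrow> 'a) set" where
  "Cmaps M = {f. continuous_on M f \<and> f ` M \<subseteq> M}"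

definition DC1_pair :: "('a::metric_space \<Rightarrow> 'a) \<Rightarrow> 'a \<Rightarrow> 'a \<Rightarrow> bool" where
  "DC1_pair f x y \<longleftrightarrow>
     (\<forall>\<delta>>0. limsup (\<lambda>n. ereal (real (card {i. i < n \<and> dist ((f^^i) x) ((f^^i) y) < \<delta>}) / real n)) = 1)
   \<and> (\<exists>\<delta>\<^sub>0>0. limsup (\<lambda>n. ereal (real (card {i. i < n \<and> dist ((f^^i) x) ((f^^i) y) > \<delta>\<^sub>0}) / real n)) = 1)"

definition exhibits_DC1 :: "'a::metric_space set \<Rightarrow> ('a \<Rightarrow> 'a) \<Rightarrow> bool" where
  "exhibits_DC1 M f \<longleftrightarrow>
     (\<exists>S\<subseteq>M. uncountable S \<and> (\<forall>x\<in>S. \<forall>y\<in>S. x \<noteq> y \<longrightarrow> DC1_pair f x y))"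

end

theory Submission
  imports Defs
begin

text \<open>Some orbit of \<open>f\<close> returns close to itself, so it contains distinct points
  \<open>p\<^sub>0, \<dots>, p\<^sub>k\<^sub>-\<^sub>1\<close> forming a periodic pseudo-orbit. Near each \<open>p\<^sub>l\<close> a chart provides a
  small arc and a way to move points continuously within a contractible neighbourhood; with a
  Tietze extension of the arc parameter, \<open>f\<close> is changed near \<open>p\<^sub>l\<close> so that the \<open>l\<close>-th arc is
  mapped onto the next one preserving the parameter, except that closing the cycle applies an
  interval map. That interval map contains a full shift, in which sequences that are constant on
  factorially growing blocks form an uncountable DC1 set.\<close>

section \<open>Distributionally scrambled codes\<close>

text \<open>Even when cut short by \<open>c\<close> steps, block \<open>j\<close> misses only a
  fraction of at most \<open>(c + 1) / (j + 1)\<close> of the times before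
  \<open>k * fact (Suc j)\<close>. The cut leaves room for looking a bounded number of digits
  ahead.\<close>

lemma limsup_density_eq_1:
  fixes P :: "nat \<Rightarrow> bool" and k c :: nat
  assumes "k > 0"
    and blocks: "\<exists>\<^sub>\<infinity>j. \<forall>i. k * fact j \<le> i \<and> i + c < k * fact (Suc j) \<longrightarrow> P i"
  shows "limsup (\<lambda>n. ereal (real (card {i. i < n \<and> P i}) / real n)) = 1"
proof (rule antisym)
  have "card {i. i < n \<and> P i} \<le> n" for n
    using card_mono[of "{..<n}" "{i. i < n \<and> P i}"] by auto
  then have "real (card {i. i < n \<and> P i}) / real n \<le> 1" for n
    by (cases "n = 0") (simp_all add: divide_le_eq_1)
  then show "limsup (\<lambda>n. ereal (real (card {i. i < n \<and> P i}) / real n)) \<le> 1"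
    by (intro Limsup_bounded always_eventually) (simp add: one_ereal_def)
next
  show "1 \<le> limsup (\<lambda>n. ereal (real (card {i. i < n \<and> P i}) / real n))"
  proof (rule ccontr)
    assume "\<not> ?thesis"
    then have "limsup (\<lambda>n. ereal (real (card {i. i < n \<and> P i}) / real n)) < 1"
      by simp
    then obtain q where q: "limsup (\<lambda>n. ereal (real (card {i. i < n \<and> P i}) / real n)) < ereal q"
        "q < 1"
      using ereal_dense2 by (force simp: one_ereal_def)
    then obtain N where N: "\<And>n. n \<ge> N \<Longrightarrow> real (card {i. i < n \<and> P i}) / real n < q"
      using Limsup_lessD[OF q(1)] by (auto simp: eventually_sequentially)
    have "(\<lambda>j. real (c + 1) * inverse (real (Suc j))) \<longlonglongrightarrow> real (c + 1) * 0"
      by (intro tendsto_mult tendsto_const LIMSEQ_inverse_real_of_nat)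
    then have "\<forall>\<^sub>F j in sequentially. real (c + 1) * inverse (real (Suc j)) < 1 - q"
      by (rule order_tendstoD(2)) (use q in simp)
    then obtain J where J: "\<And>j. j \<ge> J \<Longrightarrow> real (c + 1) * inverse (real (Suc j)) < 1 - q"
      by (auto simp: eventually_sequentially)
    obtain j where j: "j \<ge> max N J"
      and "\<forall>i. k * fact j \<le> i \<and> i + c < k * fact (Suc j) \<longrightarrow> P i"
      using blocks unfolding INFM_nat_le by blast
    then have P: "P i" if "k * fact j \<le> i" "i + c < k * fact (Suc j)" for i
      using that by blast
    define n :: nat where "n = k * fact (Suc j)"
    have "j < fact (Suc j)"
      using fact_ge_self[of "Suc j"] by linarith
    also have "\<dots> \<le> n"
      using \<open>k > 0\<close> by (simp add: n_def)
    finally have "N \<le> n"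
      using j by simp
    have n: "real n = real (Suc j) * real (k * fact j)"
      by (simp add: n_def algebra_simps)
    have pos: "real (k * fact j) \<ge> 1"
      using \<open>k > 0\<close> by (simp add: Suc_le_eq flip: of_nat_mult)
    have "{k * fact j..<n - c} \<subseteq> {i. i < n \<and> P i}"
      using P by (auto simp: n_def)
    then have "card {k * fact j..<n - c} \<le> card {i. i < n \<and> P i}"
      by (intro card_mono) auto
    then have "n \<le> card {i. i < n \<and> P i} + c + k * fact j"
      by simp
    then have "real n \<le> real (card {i. i < n \<and> P i} + c + k * fact j)"
      by (simp only: of_nat_le_iff)
    then have "real n - real c - real (k * fact j) \<le> card {i. i < n \<and> P i}"
      by simp
    \<comment> \<open>Since \<open>k * fact j\<close> is at least 1, the cut \<open>c\<close> is
      absorbed into a multiple of it, and \<open>k * fact j\<close> equals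
      \<open>n / Suc j\<close>.\<close>
    moreover have "real c + real (k * fact j) \<le> (real c + 1) * real (k * fact j)"
      using mult_left_mono[OF pos, of "real c"] by (simp add: algebra_simps)
    ultimately have "real n - (real c + 1) * real (k * fact j) \<le> card {i. i < n \<and> P i}"
      by linarith
    moreover have "real n * q < real n - (real c + 1) * real (k * fact j)"
    proof -
      have "real (c + 1) < (1 - q) * real (Suc j)"
        using J[of j] j by (simp add: field_simps)
      then have "real (c + 1) * real (k * fact j) < (1 - q) * real (Suc j) * real (k * fact j)"
        using pos by (intro mult_strict_right_mono) auto
      then show ?thesis
        unfolding n by (simp add: algebra_simps)
    qed
    ultimately have "q * real n < card {i. i < n \<and> P i}"
      by (simp add: mult.commute)
    moreover have "real n > 0"
      using pos by (simp add: n del: of_nat_Suc of_nat_mult)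
    ultimately have "q < real (card {i. i < n \<and> P i}) / real n"
      by (simp add: pos_less_divide_eq)
    with N[OF \<open>N \<le> n\<close>] show False
      by simp
  qed
qed

text \<open>The point of the middle-thirds Cantor set whose ternary digits are 2 where
  \<open>z\<close> holds and 0 elsewhere.\<close>

definition code :: "(nat \<Rightarrow> bool) \<Rightarrow> real" where
  "code z = (\<Sum>i. (if z i then 2 else 0) / 3 ^ Suc i)"

lemma summable_code: "summable (\<lambda>i. (if z i then 2 else 0) / 3 ^ Suc i :: real)"
proof (rule summable_comparison_test')
  show "summable (\<lambda>i. (1/3 :: real) ^ i)"
    by (simp add: summable_geometric)
  show "norm ((if z n then 2 else 0) / 3 ^ Suc n :: real) \<le> (1/3) ^ n" for n
    by (simp add: field_simps)
qed

lemma code_nonneg: "0 \<le> code z"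
  unfolding code_def by (intro suminf_nonneg summable_code) auto

lemma code_le_1: "code z \<le> 1"
proof -
  have sums: "(\<lambda>i. 2/3 * (1/3) ^ i) sums (2/3 * (1 / (1 - 1/3 :: real)))"
    by (intro sums_mult geometric_sums) simp
  have "code z \<le> (\<Sum>i. 2/3 * (1/3) ^ i)"
    unfolding code_def
    by (intro suminf_le summable_code sums_summable[OF sums]) (simp add: field_simps)
  then show ?thesis
    using sums_unique[OF sums] by simp
qed

lemma code_rec: "code z = (if z 0 then 2/3 else 0) + code (\<lambda>i. z (Suc i)) / 3"
proof -
  have "code z = (\<Sum>i. (if z (Suc i) then 2 else 0) / 3 ^ Suc (Suc i)) + (if z 0 then 2/3 else 0)"
    using suminf_split_head[OF summable_code[of z]] by (simp add: code_def)
  also have "(\<Sum>i. (if z (Suc i) then 2 else 0) / 3 ^ Suc (Suc i)) = code (\<lambda>i. z (Suc i)) / 3"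
    unfolding code_def
    by (subst suminf_divide[OF summable_code, symmetric]) (simp add: mult.commute)
  finally show ?thesis
    by simp
qed

text \<open>By \<open>code_rec\<close>, each leading zero contributes a factor 1/3. Hence two
  sequences that both start with many zeros have close codes.\<close>

lemma code_le_if_initial_zeros:
  assumes "\<And>i. i < n \<Longrightarrow> \<not> z i"
  shows "code z \<le> (1/3) ^ n"
  using assms
proof (induction n arbitrary: z)
  case 0
  then show ?case by (simp add: code_le_1)
next
  case (Suc n)
  have "code (\<lambda>i. z (Suc i)) \<le> (1/3) ^ n"
    using Suc.prems by (intro Suc.IH) simp
  then show ?case
    using Suc.prems[of 0] by (simp add: code_rec[of z])
qed

text \<open>The first digit decides between the intervals [0, 1/3] and [2/3, 1].\<close>

lemma code_separated:
  assumes "z 0 \<noteq> w 0"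
  shows "\<bar>code z - code w\<bar> \<ge> 1/3"
  using assms code_rec[of z] code_rec[of w]
    code_nonneg[of "\<lambda>i. z (Suc i)"] code_nonneg[of "\<lambda>i. w (Suc i)"]
    code_le_1[of "\<lambda>i. z (Suc i)"] code_le_1[of "\<lambda>i. w (Suc i)"]
  by (auto simp: abs_if split: if_splits)

text \<open>An interval map with graph of shape N; it acts on the ternary Cantor set as the shift.\<close>
definition zigzag :: "real \<Rightarrow> real" where
  "zigzag t = min (3 * t) \<bar>3 * t - 2\<bar>"

lemma continuous_on_zigzag: "continuous_on S zigzag"
  unfolding zigzag_def by (intro continuous_intros)

lemma zigzag_in_unit: "t \<in> {0..1} \<Longrightarrow> zigzag t \<in> {0..1}"
  by (auto simp: zigzag_def min_def abs_if)

text \<open>The increasing branches, \<open>3 * t\<close> on [0, 1/3] and \<open>3 * t - 2\<close>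
  on [2/3, 1], delete the first ternary digit; no code lies strictly between 1/3 and 2/3.\<close>

lemma zigzag_code: "zigzag (code z) = code (\<lambda>i. z (Suc i))"
  using code_rec[of z] code_nonneg[of "\<lambda>i. z (Suc i)"] code_le_1[of "\<lambda>i. z (Suc i)"]
  by (auto simp: zigzag_def min_def abs_if split: if_splits)

lemma zigzag_funpow_code: "(zigzag ^^ m) (code z) = code (\<lambda>i. z (m + i))"
  by (induction m) (simp_all add: zigzag_code)

text \<open>On the block \<open>fact j \<le> m < fact (Suc j)\<close> the signal is constant. Since
  \<open>\<lambda>j. fst (prod_decode j)\<close> takes every value infinitely often, all signals vanish on
  infinitely many common blocks, and each \<open>a\<close> is queried on infinitely many blocks.\<close>
definition signal :: "nat set \<Rightarrow> nat \<Rightarrow> bool" where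
  "signal A m \<longleftrightarrow>
     (\<exists>j a. fact j \<le> m \<and> m < fact (Suc j) \<and> fst (prod_decode j) = Suc a \<and> a \<in> A)"

text \<open>The blocks are disjoint because factorials are monotone; block 0 is empty, as 0! =
  1!.\<close>

lemma fact_block_unique:
  assumes "fact i \<le> m" "m < fact (Suc i)" "fact j \<le> m" "m < (fact (Suc j) :: nat)"
  shows "i = j"
proof -
  have "j \<le> i" if "fact i \<le> m" "m < fact (Suc i)" "fact j \<le> m" for i j
    using that fact_mono_nat[of "Suc i" j] by (metis leD le_trans not_less_eq_eq)
  then show ?thesis
    using assms by (simp add: le_antisym)
qed

lemma signal_block:
  assumes "fact j \<le> m" "m < fact (Suc j)"
  shows "signal A m \<longleftrightarrow> (\<exists>a\<in>A. fst (prod_decode j) = Suc a)"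
  unfolding signal_def using assms fact_block_unique by blast

lemma infinitely_often_fst_prod_decode: "\<exists>\<^sub>\<infinity>j. fst (prod_decode j) = c"
  unfolding INFM_nat_le
proof
  fix m
  have "m \<le> prod_encode (c, m)"
    by (rule le_prod_encode_2)
  then show "\<exists>n\<ge>m. fst (prod_decode n) = c"
    by (metis fst_conv prod_encode_inverse)
qed

section \<open>A cycle of arcs carrying the zigzag map\<close>

text \<open>The parameter is carried along unchanged and undergoes \<open>zigzag\<close> once per
  full turn, that is, when \<open>i mod k\<close> wraps to 0 and \<open>i div k\<close>
  increases.\<close>

lemma arc_cycle_iterate:
  fixes g :: "'a \<Rightarrow> 'a" and \<alpha> :: "nat \<Rightarrow> real \<Rightarrow> 'a"
  assumes step: "\<And>l t. \<lbrakk>Suc l < k; t \<in> {0..1}\<rbrakk> \<Longrightarrow> g (\<alpha> l t) = \<alpha> (Suc l) t"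
    and return: "\<And>l t. \<lbrakk>Suc l = k; t \<in> {0..1}\<rbrakk> \<Longrightarrow> g (\<alpha> l t) = \<alpha> 0 (zigzag t)"
    and "k > 0" "t \<in> {0..1}"
  shows "(g ^^ i) (\<alpha> 0 t) = \<alpha> (i mod k) ((zigzag ^^ (i div k)) t)"
proof (induction i)
  case 0
  then show ?case by simp
next
  case (Suc i)
  have in_unit: "(zigzag ^^ m) t \<in> {0..1}" for m
    by (induction m) (use assms(4) zigzag_in_unit in auto)
  have "i mod k < k"
    using \<open>k > 0\<close> by simp
  then consider "Suc (i mod k) < k" | "Suc (i mod k) = k"
    by linarith
  then show ?case
    by cases (use Suc.IH step in_unit return in \<open>auto simp: mod_Suc div_Suc\<close>)
qed

text \<open>The scrambled set consists of the points of arc 0 whose parameters are codes of signals.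
  Uniform continuity turns close codes into close points; injectivity and compactness keep points
  with distant codes apart.\<close>

lemma exhibits_DC1_arc_cycle:
  fixes g :: "'a::metric_space \<Rightarrow> 'a" and \<alpha> :: "nat \<Rightarrow> real \<Rightarrow> 'a"
  assumes step: "\<And>l t. \<lbrakk>Suc l < k; t \<in> {0..1}\<rbrakk> \<Longrightarrow> g (\<alpha> l t) = \<alpha> (Suc l) t"
    and return: "\<And>l t. \<lbrakk>Suc l = k; t \<in> {0..1}\<rbrakk> \<Longrightarrow> g (\<alpha> l t) = \<alpha> 0 (zigzag t)"
    and "k > 0"
    and cont: "\<And>l. l < k \<Longrightarrow> continuous_on {0..1} (\<alpha> l)"
    and inj: "\<And>l. l < k \<Longrightarrow> inj_on (\<alpha> l) {0..1}"
    and sub: "\<alpha> 0 ` {0..1} \<subseteq> M"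
  shows "exhibits_DC1 M g"
proof -
  define point where "point A = \<alpha> 0 (code (signal A))" for A
  have code_in: "code z \<in> {0..1}" for z
    by (simp add: code_nonneg code_le_1)
  have orbit: "(g ^^ i) (point A) = \<alpha> (i mod k) (code (\<lambda>n. signal A (i div k + n)))" for i A
    unfolding point_def
    by (subst arc_cycle_iterate[where k = k])
      (auto simp: step return \<open>k > 0\<close> code_nonneg code_le_1 zigzag_funpow_code)
  have near: "limsup (\<lambda>n. ereal (real (card {i. i < n \<and>
      dist ((g ^^ i) (point A)) ((g ^^ i) (point B)) < \<delta>}) / real n)) = 1"
    if "\<delta> > 0" for A B \<delta>
  proof -
    have "\<exists>\<eta>>0. \<forall>s\<in>{0..1}. \<forall>t\<in>{0..1}. \<bar>s - t\<bar> < \<eta> \<longrightarrow> dist (\<alpha> l s) (\<alpha> l t) < \<delta>"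
      if "l < k" for l
      using compact_uniformly_continuous[OF cont[OF that] compact_Icc] \<open>\<delta> > 0\<close>
      unfolding uniformly_continuous_on_def dist_real_def by (metis abs_minus_commute)
    then obtain \<eta> where \<eta>: "\<And>l. l < k \<Longrightarrow> \<eta> l > 0" "\<And>l s t. \<lbrakk>l < k; s \<in> {0..1};
        t \<in> {0..1}; \<bar>s - t\<bar> < \<eta> l\<rbrakk> \<Longrightarrow> dist (\<alpha> l s) (\<alpha> l t) < \<delta>"
      by metis
    have "Min (\<eta> ` {..<k}) > 0"
      using \<open>k > 0\<close> \<eta>(1) by (subst Min_gr_iff) auto
    \<comment> \<open>\<open>L\<close> common leading zeros bring two codes within the modulus of
      continuity of every arc at once.\<close>
    then obtain L where L: "(1/3) ^ L < Min (\<eta> ` {..<k})"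
      using real_arch_pow_inv[of "Min (\<eta> ` {..<k})" "1/3"] by auto
    \<comment> \<open>On blocks with value 0 all signals vanish. Stopping \<open>k * L\<close> steps
      early keeps the next \<open>L\<close> digits inside the block.\<close>
    have "\<exists>\<^sub>\<infinity>j. \<forall>i. k * fact j \<le> i \<and> i + k * L < k * fact (Suc j) \<longrightarrow>
        dist ((g ^^ i) (point A)) ((g ^^ i) (point B)) < \<delta>"
      using infinitely_often_fst_prod_decode[of 0]
    proof (rule INFM_mono, intro allI impI)
      fix j i
      assume j: "fst (prod_decode j) = 0" and i: "k * fact j \<le> i \<and> i + k * L < k * fact (Suc j)"
      have "fact j \<le> i div k"
        using i \<open>k > 0\<close> by (simp add: less_eq_div_iff_mult_less_eq mult.commute)
      moreover have "i div k + L < fact (Suc j)"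
      proof -
        have "(i + k * L) div k < fact (Suc j)"
          using i \<open>k > 0\<close> by (subst div_less_iff_less_mult) (simp_all only: mult.commute)
        then show ?thesis
          using \<open>k > 0\<close> by (simp add: add.commute)
      qed
      ultimately have zero: "\<not> signal C (i div k + n)" if "n < L" for n C
        using that j by (subst signal_block[of j]) auto
      have "code (\<lambda>n. signal C (i div k + n)) \<le> (1/3) ^ L" for C
        by (intro code_le_if_initial_zeros zero)
      from this[of A] this[of B]
      have "\<bar>code (\<lambda>n. signal A (i div k + n)) - code (\<lambda>n. signal B (i div k + n))\<bar> \<le> (1/3) ^ L"
        using code_nonneg[of "\<lambda>n. signal A (i div k + n)"]
          code_nonneg[of "\<lambda>n. signal B (i div k + n)"] by linarith
      also have "\<dots> < Min (\<eta> ` {..<k})"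
        by (fact L)
      also have "\<dots> \<le> \<eta> (i mod k)"
        using \<open>k > 0\<close> by (intro Min_le) auto
      finally show "dist ((g ^^ i) (point A)) ((g ^^ i) (point B)) < \<delta>"
        unfolding orbit using \<open>k > 0\<close> by (intro \<eta> code_in) auto
    qed
    then show ?thesis
      by (rule limsup_density_eq_1[OF \<open>k > 0\<close>])
  qed
  \<comment> \<open>On the compact set of parameter pairs at least 1/3 apart, the distance of the
    arc points attains a minimum, positive by injectivity.\<close>
  have "\<exists>r>0. \<forall>s\<in>{0..1}. \<forall>t\<in>{0..1}. \<bar>s - t\<bar> \<ge> 1/3 \<longrightarrow> dist (\<alpha> l s) (\<alpha> l t) > r"
    if "l < k" for l
  proof -
    define K where "K = {0..1} \<times> {0..1} \<inter> {st :: real \<times> real. \<bar>fst st - snd st\<bar> \<ge> 1/3}"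
    have "compact K"
      unfolding K_def
      by (intro compact_Int_closed compact_Times compact_Icc closed_Collect_le continuous_intros)
    moreover have "(1, 0) \<in> K"
      by (simp add: K_def)
    moreover have "continuous_on K (\<lambda>st. dist (\<alpha> l (fst st)) (\<alpha> l (snd st)))"
      by (intro continuous_intros continuous_on_compose2[OF cont[OF that]]) (auto simp: K_def)
    ultimately have "\<exists>st\<in>K. \<forall>uv\<in>K.
        dist (\<alpha> l (fst st)) (\<alpha> l (snd st)) \<le> dist (\<alpha> l (fst uv)) (\<alpha> l (snd uv))"
      by (intro continuous_attains_inf) auto
    then obtain st where st: "st \<in> K" "\<And>uv. uv \<in> K \<Longrightarrow>
        dist (\<alpha> l (fst st)) (\<alpha> l (snd st)) \<le> dist (\<alpha> l (fst uv)) (\<alpha> l (snd uv))"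
      by blast
    \<comment> \<open>Halving the minimum makes the later inequality strict.\<close>
    define r where "r = dist (\<alpha> l (fst st)) (\<alpha> l (snd st)) / 2"
    have "\<alpha> l (fst st) \<noteq> \<alpha> l (snd st)"
      using st(1) inj_onD[OF inj[OF that]] by (force simp: K_def)
    then have "r > 0"
      by (simp add: r_def)
    moreover have "dist (\<alpha> l s) (\<alpha> l t) > r"
      if "s \<in> {0..1}" "t \<in> {0..1}" "\<bar>s - t\<bar> \<ge> 1/3" for s t
    proof -
      have "2 * r \<le> dist (\<alpha> l s) (\<alpha> l t)"
        using st(2)[of "(s, t)"] that by (simp add: K_def r_def)
      then show ?thesis
        using \<open>r > 0\<close> by linarith
    qed
    ultimately show ?thesis
      by blast
  qed
  then obtain r where r: "\<And>l. l < k \<Longrightarrow> r l > 0" "\<And>l s t. \<lbrakk>l < k; s \<in> {0..1};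
      t \<in> {0..1}; \<bar>s - t\<bar> \<ge> 1/3\<rbrakk> \<Longrightarrow> dist (\<alpha> l s) (\<alpha> l t) > r l"
    by metis
  define \<delta>\<^sub>0 where "\<delta>\<^sub>0 = Min (r ` {..<k})"
  have "\<delta>\<^sub>0 > 0"
    unfolding \<delta>\<^sub>0_def using \<open>k > 0\<close> r(1) by (subst Min_gr_iff) auto
  have far_often: "\<exists>\<^sub>\<infinity>j. \<forall>i. k * fact j \<le> i \<and> i + 0 < k * fact (Suc j) \<longrightarrow>
      dist ((g ^^ i) (point A)) ((g ^^ i) (point B)) > \<delta>\<^sub>0" if "A \<noteq> B" for A B
  proof -
    \<comment> \<open>On blocks that query this \<open>a\<close> the two signals differ, so the
      codes differ in their first digit throughout; no digits ahead are read, hence the cut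
      0.\<close>
    obtain a where a: "a \<in> A \<longleftrightarrow> a \<notin> B"
      using \<open>A \<noteq> B\<close> by blast
    show ?thesis
      using infinitely_often_fst_prod_decode[of "Suc a"]
    proof (rule INFM_mono, intro allI impI)
      fix j i
      assume j: "fst (prod_decode j) = Suc a" and i: "k * fact j \<le> i \<and> i + 0 < k * fact (Suc j)"
      have block: "fact j \<le> i div k" "i div k < fact (Suc j)"
        using i \<open>k > 0\<close>
        by (simp_all add: less_eq_div_iff_mult_less_eq div_less_iff_less_mult mult.commute)
      have "signal A (i div k + 0) \<noteq> signal B (i div k + 0)"
        using a j by (simp add: signal_block[OF block])
      then have "\<bar>code (\<lambda>n. signal A (i div k + n)) - code (\<lambda>n. signal B (i div k + n))\<bar> \<ge> 1/3"
        by (rule code_separated)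
      then have "dist ((g ^^ i) (point A)) ((g ^^ i) (point B)) > r (i mod k)"
        unfolding orbit using \<open>k > 0\<close> by (intro r code_in) auto
      moreover have "\<delta>\<^sub>0 \<le> r (i mod k)"
        unfolding \<delta>\<^sub>0_def using \<open>k > 0\<close> by (intro Min_le) auto
      ultimately show "dist ((g ^^ i) (point A)) ((g ^^ i) (point B)) > \<delta>\<^sub>0"
        by simp
    qed
  qed
  have far: "limsup (\<lambda>n. ereal (real (card {i. i < n \<and>
      dist ((g ^^ i) (point A)) ((g ^^ i) (point B)) > \<delta>\<^sub>0}) / real n)) = 1" if "A \<noteq> B" for A B
    using far_often[OF that] by (rule limsup_density_eq_1[OF \<open>k > 0\<close>])
  \<comment> \<open>If two distinct sets gave the same point, all distances would be 0 and the upper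
    density in \<open>far\<close> would be 0 instead of 1.\<close>
  have "inj point"
  proof (rule injI, rule ccontr)
    fix A B
    assume "point A = point B" "A \<noteq> B"
    then show False
      using far[of A B] \<open>\<delta>\<^sub>0 > 0\<close> by (simp add: Limsup_const)
  qed
  moreover have "uncountable (UNIV :: nat set set)"
    unfolding uncountable_def using Cantors_theorem[of "UNIV :: nat set"] by auto
  ultimately have "uncountable (range point)"
    using countable_image_inj_on by blast
  moreover have "range point \<subseteq> M"
    using sub code_in by (auto simp: point_def)
  moreover have "DC1_pair g x y" if xy: "x \<in> range point" "y \<in> range point" "x \<noteq> y" for x y
  proof -
    obtain A B where "x = point A" "y = point B" "A \<noteq> B"
      using xy by blast
    then show ?thesis
      unfolding DC1_pair_def
      by (intro conjI allI impI exI[of _ \<delta>\<^sub>0]) (simp_all add: near far \<open>\<delta>\<^sub>0 > 0\<close>)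
  qed
  ultimately show ?thesis
    unfolding exhibits_DC1_def by blast
qed

section \<open>Local modifications\<close>

text \<open>Equivalent to contractibility; stated directly because the library lemmas on
  homotopies into contractible sets require normed vector spaces.\<close>
definition blendable :: "'a::topological_space set \<Rightarrow> bool" where
  "blendable W \<longleftrightarrow> (\<exists>H. continuous_on (W \<times> W \<times> {0..1::real}) (\<lambda>(x, y, s). H x y s) \<and>
     (\<forall>x\<in>W. \<forall>y\<in>W. (\<forall>s\<in>{0..1}. H x y s \<in> W) \<and> H x y 0 = x \<and> H x y 1 = y))"

text \<open>Straight segments in \<open>C\<close> are pulled back along the homeomorphism.\<close>

lemma blendable_homeomorphic_convex:
  fixes C :: "'b::real_normed_vector set"
  assumes hom: "homeomorphism W C h h'" and "convex C"
  shows "blendable W"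
  unfolding blendable_def
proof (intro exI conjI ballI)
  let ?H = "\<lambda>x y s. h' ((1 - s) *\<^sub>R h x + s *\<^sub>R h y)"
  have h: "h x \<in> C" "h' (h x) = x" if "x \<in> W" for x
    using hom that by (auto simp: homeomorphism_def)
  have h': "h' c \<in> W" if "c \<in> C" for c
    using hom that by (auto simp: homeomorphism_def)
  have convex: "(1 - s) *\<^sub>R h x + s *\<^sub>R h y \<in> C" if "x \<in> W" "y \<in> W" "s \<in> {0..1}" for x y s
    using that h \<open>convex C\<close> by (auto simp: convex_alt)
  have cont: "continuous_on W h" "continuous_on C h'"
    using hom by (auto simp: homeomorphism_def)
  have "continuous_on (W \<times> W \<times> {0..1}) (\<lambda>p. (1 - snd (snd p)) *\<^sub>R h (fst p)
      + snd (snd p) *\<^sub>R h (fst (snd p)))"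
    by (intro continuous_intros continuous_on_compose2[OF cont(1)]) auto
  then have "continuous_on (W \<times> W \<times> {0..1})
      (\<lambda>p. ?H (fst p) (fst (snd p)) (snd (snd p)))"
    by (rule continuous_on_compose2[OF cont(2)]) (use convex in auto)
  then show "continuous_on (W \<times> W \<times> {0..1}) (\<lambda>(x, y, s). ?H x y s)"
    by (simp add: case_prod_beta)
  show "?H x y s \<in> W" if "x \<in> W" "y \<in> W" "s \<in> {0..1}" for x y s
    using that by (intro h' convex)
  show "?H x y 0 = x" "?H x y 1 = y" if "x \<in> W" "y \<in> W" for x y
    using that h by simp_all
qed

text \<open>In a chart, a small ball around the image of \<open>p\<close> meets the half-space in a
  convex set; its preimage is the neighbourhood, and the arc is the preimage of a segment.\<close>

lemma manifold_small_neighbourhood: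
  fixes M :: "'a::metric_space set"
  assumes "topological_manifold_with_boundary TYPE('n::finite) M" "p \<in> M" "\<eta> > 0"
  obtains W \<alpha> where "openin (top_of_set M) W" "p \<in> W" "W \<subseteq> ball p \<eta>" "blendable W"
    "continuous_on {0..1::real} \<alpha>" "inj_on \<alpha> {0..1}" "\<alpha> ` {0..1} \<subseteq> W"
proof -
  obtain k :: 'n and U V where U: "openin (top_of_set M) U" "p \<in> U"
    and V: "openin (top_of_set (half_space k)) V" and "U homeomorphic V"
    using assms(1,2) unfolding topological_manifold_with_boundary_def by meson
  then obtain h h' where hom: "homeomorphism U V h h'"
    unfolding homeomorphic_def by blast
  have "openin (top_of_set U) (U \<inter> ball p \<eta>)"
    by (simp add: openin_open_Int)
  then have "openin (top_of_set V) (h ` (U \<inter> ball p \<eta>))"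
    by (rule homeomorphism_imp_open_map[OF hom])
  then have "openin (top_of_set (half_space k)) (h ` (U \<inter> ball p \<eta>))"
    using V openin_trans by blast
  moreover have "h p \<in> h ` (U \<inter> ball p \<eta>)"
    using U(2) \<open>\<eta> > 0\<close> by simp
  ultimately obtain r where r: "r > 0" "ball (h p) r \<inter> half_space k \<subseteq> h ` (U \<inter> ball p \<eta>)"
    unfolding openin_contains_ball by blast
  define C where "C = ball (h p) r \<inter> half_space k"
  have "h ` U = V" "h' ` V = U"
    using hom by (auto simp: homeomorphism_def)
  have "C \<subseteq> V"
    using r(2) \<open>h ` U = V\<close> by (auto simp: C_def)
  have homW: "homeomorphism (h' ` C) C h h'"
    by (rule homeomorphism_of_subsets[OF homeomorphism_symD[OF hom], THEN homeomorphism_symD])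
      (use \<open>C \<subseteq> V\<close> \<open>h' ` V = U\<close> in auto)
  have hp: "h p \<in> half_space k"
    using U(2) \<open>h ` U = V\<close> openin_imp_subset[OF V] by blast
  have "convex (half_space k)"
    unfolding half_space_def using convex_halfspace_ge[of 0 "axis k 1 :: real^'n"]
    by (simp add: cart_eq_inner_axis inner_commute)
  then have "convex C"
    unfolding C_def by (intro convex_Int convex_ball)
  have h'h: "h' (h x) = x" if "x \<in> U" for x
    using hom that by (auto simp: homeomorphism_def)
  show thesis
  proof
    show "openin (top_of_set M) (h' ` C)"
    proof -
      have "openin (top_of_set (half_space k)) C"
        unfolding C_def by (simp add: Int_commute openin_open_Int)
      then have "openin (top_of_set V) C"
        using \<open>C \<subseteq> V\<close> V by (meson openin_imp_subset openin_subset_trans)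
      then have "openin (top_of_set U) (h' ` C)"
        by (rule homeomorphism_imp_open_map[OF homeomorphism_symD[OF hom]])
      then show ?thesis
        using U(1) openin_trans by blast
    qed
    show "p \<in> h' ` C"
      using h'h[OF U(2)] hp r(1) by (intro image_eqI[of _ _ "h p"]) (auto simp: C_def)
    show "h' ` C \<subseteq> ball p \<eta>"
      using r(2) h'h unfolding C_def by auto
    show "blendable (h' ` C)"
      using homW \<open>convex C\<close> by (rule blendable_homeomorphic_convex)
    \<comment> \<open>The segment points in the direction of the constrained coordinate, so it stays
      in the half-space even if it starts on the boundary.\<close>
    let ?c = "\<lambda>t :: real. h p + (t * (r / 2)) *\<^sub>R axis k 1"
    have in_C: "?c t \<in> C" if "t \<in> {0..1}" for t
      using that hp r(1) by (auto simp: C_def half_space_def dist_norm abs_mult)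
    have "continuous_on C h'" "inj_on h' C"
      using homW by (auto simp: homeomorphism_def intro: inj_on_inverseI)
    have "continuous_on {0..1} ?c"
      by (intro continuous_intros)
    then show "continuous_on {0..1} (\<lambda>t. h' (?c t))"
      by (rule continuous_on_compose2[OF \<open>continuous_on C h'\<close>]) (use in_C in blast)
    show "inj_on (\<lambda>t. h' (?c t)) {0..1}"
    proof (rule inj_onI)
      fix s t :: real
      assume "s \<in> {0..1}" "t \<in> {0..1}" "h' (?c s) = h' (?c t)"
      then have "?c s = ?c t"
        using in_C inj_onD[OF \<open>inj_on h' C\<close>] by blast
      then show "s = t"
        using r(1) by (simp add: axis_eq_0_iff)
    qed
    show "(\<lambda>t. h' (?c t)) ` {0..1} \<subseteq> h' ` C"
      using in_C by blast
  qed
qed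

text \<open>An injective continuous image of a compact interval is closed with continuous inverse,
  so the Tietze theorem applies to the inverse.\<close>

lemma arc_parameter_extension:
  fixes M :: "'a::metric_space set" and \<alpha> :: "real \<Rightarrow> 'a"
  assumes "continuous_on {0..1} \<alpha>" "inj_on \<alpha> {0..1}" "\<alpha> ` {0..1} \<subseteq> M"
  obtains \<tau> where "continuous_on M \<tau>" "\<tau> ` M \<subseteq> {0..1}" "\<And>t. t \<in> {0..1} \<Longrightarrow> \<tau> (\<alpha> t) = t"
proof -
  let ?A = "\<alpha> ` {0..1}"
  define \<theta> where "\<theta> = the_inv_into {0..1} \<alpha>"
  have \<theta>: "\<theta> (\<alpha> t) = t" if "t \<in> {0..1}" for t
    unfolding \<theta>_def using assms(2) that by (rule the_inv_into_f_f)
  have "continuous_on ?A \<theta>"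
    by (rule continuous_on_inv) (use assms(1) \<theta> in auto)
  then have cont: "continuous_map (subtopology (top_of_set M) ?A) euclideanreal \<theta>"
    using assms(3) by (simp add: subtopology_subtopology inf_absorb2)
  have "closed ?A"
    using assms(1) by (intro compact_imp_closed compact_continuous_image) auto
  then have closed: "closedin (top_of_set M) ?A"
    using assms(3) by (simp add: closed_subset)
  have normal: "normal_space (top_of_set M)"
    by (intro metrizable_imp_normal_space metrizable_space_subtopology metrizable_space_euclidean)
  obtain \<tau> where "continuous_map (top_of_set M) euclideanreal \<tau>"
      "\<tau> ` topspace (top_of_set M) \<subseteq> {0..1}" "\<And>x. x \<in> ?A \<Longrightarrow> \<tau> x = \<theta> x"
    by (rule Tietze_extension_realinterval[OF normal closed _ _ cont, of "{0..1}"])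
      (use \<theta> in \<open>auto simp: is_interval_cc\<close>)
  then show thesis
    using that[of \<tau>] \<theta> by simp
qed

text \<open>Inside the ball, \<open>f x\<close> is moved within \<open>W\<close> towards
  \<open>\<beta> (\<tau> x)\<close>, where \<open>\<tau>\<close> extends the parameter of the arc:
  completely on the half-radius ball, not at all on the sphere.\<close>

lemma redirect_arc:
  fixes M :: "'a::metric_space set"
  assumes f: "f \<in> Cmaps M" and "\<rho> > 0"
    and W: "blendable W" "W \<subseteq> M" "f ` (M \<inter> cball p \<rho>) \<subseteq> W"
    and \<alpha>: "continuous_on {0..1} \<alpha>" "inj_on \<alpha> {0..1}" "\<alpha> ` {0..1::real} \<subseteq> M \<inter> cball p (\<rho> / 2)"
    and \<beta>: "continuous_on {0..1} \<beta>" "\<beta> ` {0..1::real} \<subseteq> W"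
  obtains g where "g \<in> Cmaps M" "\<And>x. \<lbrakk>x \<in> M; x \<notin> cball p \<rho>\<rbrakk> \<Longrightarrow> g x = f x"
    "g ` (M \<inter> cball p \<rho>) \<subseteq> W" "\<And>t. t \<in> {0..1} \<Longrightarrow> g (\<alpha> t) = \<beta> t"
proof -
  obtain H where contH: "continuous_on (W \<times> W \<times> {0..1::real}) (\<lambda>(x, y, s). H x y s)"
    and HW: "\<And>x y s. \<lbrakk>x \<in> W; y \<in> W; s \<in> {0..1}\<rbrakk> \<Longrightarrow> H x y s \<in> W"
    and H01: "\<And>x y. \<lbrakk>x \<in> W; y \<in> W\<rbrakk> \<Longrightarrow> H x y 0 = x" "\<And>x y. \<lbrakk>x \<in> W; y \<in> W\<rbrakk> \<Longrightarrow> H x y 1 = y"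
    using W(1) unfolding blendable_def by metis
  obtain \<tau> where \<tau>: "continuous_on M \<tau>" "\<tau> ` M \<subseteq> {0..1}" "\<And>t. t \<in> {0..1} \<Longrightarrow> \<tau> (\<alpha> t) = t"
    using arc_parameter_extension[OF \<alpha>(1,2)] \<alpha>(3) by (metis le_infE)
  \<comment> \<open>The weight is 1 up to distance \<open>\<rho> / 2\<close> and falls linearly to 0
    at distance \<open>\<rho>\<close>, where the two pieces of \<open>g\<close> must agree.\<close>
  define wt where "wt x = min 1 (2 - 2 * dist p x / \<rho>)" for x
  have wt: "wt x \<in> {0..1}" if "x \<in> cball p \<rho>" for x
    using that \<open>\<rho> > 0\<close> by (auto simp: wt_def field_simps)
  define b where "b x = H (f x) (\<beta> (\<tau> x)) (wt x)" for x
  define g where "g x = (if dist p x < \<rho> then b x else f x)" for x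
  have contf: "continuous_on M f" and fM: "f ` M \<subseteq> M"
    using f by (auto simp: Cmaps_def)
  have \<beta>W: "\<beta> (\<tau> x) \<in> W" if "x \<in> M" for x
    using that \<tau>(2) \<beta>(2) by blast
  have b_in: "b x \<in> W" if "x \<in> M \<inter> cball p \<rho>" for x
    unfolding b_def using that W(3) \<beta>W wt by (intro HW) blast+
  have "continuous_on (M \<inter> cball p \<rho>) (\<lambda>x. (f x, \<beta> (\<tau> x), wt x))"
    unfolding wt_def using \<open>\<rho> > 0\<close> \<tau>(2)
    by (intro continuous_intros continuous_on_compose2[OF \<beta>(1)]
        continuous_on_subset[OF contf] continuous_on_subset[OF \<tau>(1)]) auto
  then have "continuous_on (M \<inter> cball p \<rho>) (\<lambda>x. (\<lambda>(x, y, s). H x y s) (f x, \<beta> (\<tau> x), wt x))"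
    by (rule continuous_on_compose2[OF contH]) (use W(3) \<beta>W wt in blast)
  then have contb: "continuous_on (M \<inter> cball p \<rho>) b"
    by (simp add: b_def[abs_def])
  have "continuous_on (M \<inter> cball p \<rho> \<union> (M - ball p \<rho>)) g"
    unfolding g_def
  proof (rule continuous_on_cases_local)
    have M: "M \<inter> cball p \<rho> \<union> (M - ball p \<rho>) = M"
      by auto
    show "closedin (top_of_set (M \<inter> cball p \<rho> \<union> (M - ball p \<rho>))) (M \<inter> cball p \<rho>)"
      unfolding M by (simp add: closedin_closed_Int)
    show "closedin (top_of_set (M \<inter> cball p \<rho> \<union> (M - ball p \<rho>))) (M - ball p \<rho>)"
      unfolding M by (simp add: Diff_eq closed_Compl closedin_closed_Int)
    show "continuous_on (M \<inter> cball p \<rho>) b" "continuous_on (M - ball p \<rho>) f"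
      using contb contf by (auto intro: continuous_on_subset)
    fix x
    assume "x \<in> M \<inter> cball p \<rho> \<and> \<not> dist p x < \<rho> \<or> x \<in> M - ball p \<rho> \<and> dist p x < \<rho>"
    then have x: "x \<in> M \<inter> cball p \<rho>" "dist p x = \<rho>"
      by auto
    then have "wt x = 0"
      using \<open>\<rho> > 0\<close> by (simp add: wt_def)
    then show "b x = f x"
      using x W(3) \<beta>W by (auto simp: b_def intro!: H01)
  qed
  moreover have "M \<inter> cball p \<rho> \<union> (M - ball p \<rho>) = M"
    by auto
  ultimately have contg: "continuous_on M g"
    by simp
  show thesis
  proof
    show gW: "g ` (M \<inter> cball p \<rho>) \<subseteq> W"
      using b_in W(3) by (auto simp: g_def)
    show gf: "g x = f x" if "x \<in> M" "x \<notin> cball p \<rho>" for x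
      using that by (simp add: g_def)
    show "g \<in> Cmaps M"
      unfolding Cmaps_def using contg gW gf fM W(2) by blast
    show "g (\<alpha> t) = \<beta> t" if t: "t \<in> {0..1}" for t
    proof -
      have x: "\<alpha> t \<in> M" "dist p (\<alpha> t) \<le> \<rho> / 2"
        using subsetD[OF \<alpha>(3) imageI[OF t]] by simp_all
      then have "wt (\<alpha> t) = 1" "dist p (\<alpha> t) < \<rho>" "f (\<alpha> t) \<in> W"
        using \<open>\<rho> > 0\<close> W(3) by (auto simp: wt_def field_simps)
      then show ?thesis
        using t \<tau>(3) \<beta>(2) by (auto simp: g_def b_def intro!: H01)
    qed
  qed
qed

text \<open>The arcs are treated one at a time. As the balls are disjoint, each modification leaves
  the map unchanged on the other balls and so preserves the earlier arcs.\<close>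

lemma redirect_arcs:
  fixes M :: "'a::metric_space set" and m :: nat
  assumes f: "f \<in> Cmaps M" and "\<rho> > 0"
    and disj: "\<And>i j. \<lbrakk>i < m; j < m; i \<noteq> j\<rbrakk> \<Longrightarrow> cball (p i) \<rho> \<inter> cball (p j) \<rho> = {}"
    and W: "\<And>l. l < m \<Longrightarrow> blendable (W l)" "\<And>l. l < m \<Longrightarrow> W l \<subseteq> M"
      "\<And>l. l < m \<Longrightarrow> f ` (M \<inter> cball (p l) \<rho>) \<subseteq> W l"
    and \<alpha>: "\<And>l. l < m \<Longrightarrow> continuous_on {0..1} (\<alpha> l)" "\<And>l. l < m \<Longrightarrow> inj_on (\<alpha> l) {0..1}"
      "\<And>l. l < m \<Longrightarrow> \<alpha> l ` {0..1::real} \<subseteq> M \<inter> cball (p l) (\<rho> / 2)"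
    and \<beta>: "\<And>l. l < m \<Longrightarrow> continuous_on {0..1} (\<beta> l)" "\<And>l. l < m \<Longrightarrow> \<beta> l ` {0..1::real} \<subseteq> W l"
  shows "\<exists>g\<in>Cmaps M. (\<forall>l<m. \<forall>t\<in>{0..1}. g (\<alpha> l t) = \<beta> l t) \<and>
    (\<forall>x\<in>M. g x = f x \<or> (\<exists>l<m. x \<in> cball (p l) \<rho> \<and> g x \<in> W l))"
  using disj W \<alpha> \<beta>
proof (induction m)
  case 0
  then show ?case using f by auto
next
  case (Suc m)
  obtain g where g: "g \<in> Cmaps M" "\<And>l t. \<lbrakk>l < m; t \<in> {0..1}\<rbrakk> \<Longrightarrow> g (\<alpha> l t) = \<beta> l t"
      "\<And>x. x \<in> M \<Longrightarrow> g x = f x \<or> (\<exists>l<m. x \<in> cball (p l) \<rho> \<and> g x \<in> W l)"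
  proof -
    have "\<exists>g\<in>Cmaps M. (\<forall>l<m. \<forall>t\<in>{0..1}. g (\<alpha> l t) = \<beta> l t) \<and>
      (\<forall>x\<in>M. g x = f x \<or> (\<exists>l<m. x \<in> cball (p l) \<rho> \<and> g x \<in> W l))"
      by (rule Suc.IH; intro Suc.prems; simp)
    then show ?thesis
      using that by metis
  qed
  have away: "x \<notin> cball (p m) \<rho>" if "l < m" "x \<in> cball (p l) \<rho>" for x l
    using that Suc.prems(1)[of l m] by auto
  have "g x = f x" if "x \<in> M \<inter> cball (p m) \<rho>" for x
    using that g(3)[of x] away by blast
  then have gW: "g ` (M \<inter> cball (p m) \<rho>) \<subseteq> W m"
    using Suc.prems(4)[of m] by force
  obtain g' where g': "g' \<in> Cmaps M" "\<And>x. \<lbrakk>x \<in> M; x \<notin> cball (p m) \<rho>\<rbrakk> \<Longrightarrow> g' x = g x"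
      "g' ` (M \<inter> cball (p m) \<rho>) \<subseteq> W m" "\<And>t. t \<in> {0..1} \<Longrightarrow> g' (\<alpha> m t) = \<beta> m t"
    using redirect_arc[OF g(1) \<open>\<rho> > 0\<close> Suc.prems(2,3)[OF lessI] gW Suc.prems(5,6,7,8,9)[OF lessI]]
    by metis
  have "g' (\<alpha> l t) = \<beta> l t" if "l < Suc m" "t \<in> {0..1}" for l t
  proof (cases "l = m")
    case False
    then have "l < m"
      using that(1) by simp
    have "\<alpha> l t \<in> M \<inter> cball (p l) (\<rho> / 2)"
      using Suc.prems(7)[OF that(1)] that(2) by blast
    then have "\<alpha> l t \<in> M" "\<alpha> l t \<notin> cball (p m) \<rho>"
      using away[OF \<open>l < m\<close>, of "\<alpha> l t"] \<open>\<rho> > 0\<close> by auto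
    then show ?thesis
      using g'(2) g(2) \<open>l < m\<close> that(2) by simp
  qed (use g'(4) that in simp)
  moreover have "g' x = f x \<or> (\<exists>l<Suc m. x \<in> cball (p l) \<rho> \<and> g' x \<in> W l)" if "x \<in> M" for x
  proof (cases "x \<in> cball (p m) \<rho>")
    case True
    then show ?thesis using g'(3) that by blast
  next
    case False
    then show ?thesis using g'(2) g(3) that by (metis less_SucI)
  qed
  ultimately show ?case
    using g'(1) by blast
qed

text \<open>Stating smallness of the radius as an eventual property lets finitely many such
  conditions be combined.\<close>

lemma eventually_cball_subset_openin:
  fixes M :: "'a::metric_space set"
  assumes "openin (top_of_set M) S" "q \<in> S"
  shows "\<forall>\<^sub>F \<rho> in at_right 0. M \<inter> cball q \<rho> \<subseteq> S"
proof -
  obtain e where "e > 0" "ball q e \<inter> M \<subseteq> S"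
    using assms unfolding openin_contains_ball by blast
  then show ?thesis
    unfolding eventually_at_right_field by (intro exI[of _ e]) (auto simp: subset_iff)
qed

lemma eventually_disjoint_cballs:
  fixes a b :: "'a::metric_space"
  assumes "a \<noteq> b"
  shows "\<forall>\<^sub>F \<rho> in at_right 0. cball a \<rho> \<inter> cball b \<rho> = {}"
  unfolding eventually_at_right_field
proof (intro exI[of _ "dist a b / 2"] conjI allI impI)
  show "0 < dist a b / 2"
    using assms by simp
  fix \<rho> :: real
  assume "\<rho> < dist a b / 2"
  moreover have "dist a b \<le> 2 * \<rho>" if "x \<in> cball a \<rho>" "x \<in> cball b \<rho>" for x
    using that dist_triangle2[of a b x] by (simp add: dist_commute)
  ultimately show "cball a \<rho> \<inter> cball b \<rho> = {}"
    by fastforce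
qed

section \<open>Density of distributional chaos\<close>

theorem theorem1p1:
  fixes M :: "'a::metric_space set"
  assumes "topological_manifold_with_boundary TYPE('n::finite) M"
    and "compact M" and "M \<noteq> {}"
  shows "\<forall>f\<in>Cmaps M. \<forall>\<epsilon>>0. \<exists>g\<in>Cmaps M. exhibits_DC1 M g \<and>
           (SUP x\<in>M. dist (f x) (g x)) < \<epsilon>"
proof (intro ballI allI impI)
  fix f :: "'a \<Rightarrow> 'a" and \<epsilon> :: real
  assume f: "f \<in> Cmaps M" and "\<epsilon> > 0"
  then have contf: "continuous_on M f" and fM: "f ` M \<subseteq> M"
    by (auto simp: Cmaps_def)
  note chart = manifold_small_neighbourhood[OF assms(1)]
  \<comment> \<open>Where the map changes, old and new values share a ball of radius
    \<open>\<eta>\<close>. The resulting bound \<open>2 * \<eta>\<close> stays below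
    \<open>\<epsilon>\<close> after taking the supremum.\<close>
  define \<eta> where "\<eta> = \<epsilon> / 3"
  have "\<eta> > 0"
    using \<open>\<epsilon> > 0\<close> by (simp add: \<eta>_def)

  \<comment> \<open>A shortest return of an orbit\<close>
  obtain x\<^sub>0 where "x\<^sub>0 \<in> M"
    using \<open>M \<noteq> {}\<close> by blast
  define x where "x n = (f ^^ n) x\<^sub>0" for n
  have xM: "x n \<in> M" for n
    unfolding x_def by (induction n) (use \<open>x\<^sub>0 \<in> M\<close> fM in auto)
  obtain z r where z: "z \<in> M" "strict_mono r" "(x \<circ> r) \<longlonglongrightarrow> z"
    using compact_imp_seq_compact[OF \<open>compact M\<close>] xM by (meson seq_compactE)
  obtain W\<^sub>0 where W\<^sub>0: "openin (top_of_set M) W\<^sub>0" "z \<in> W\<^sub>0" "W\<^sub>0 \<subseteq> ball z \<eta>" "blendable W\<^sub>0"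
    using chart[OF z(1) \<open>\<eta> > 0\<close>] by metis
  define returns where "returns n \<longleftrightarrow> n > 0 \<and> (\<exists>i. x i \<in> W\<^sub>0 \<and> x (i + n) \<in> W\<^sub>0)" for n
  have "\<exists>n. returns n"
  proof -
    obtain T where T: "open T" "W\<^sub>0 = M \<inter> T"
      using W\<^sub>0(1) unfolding openin_open by blast
    then have "\<forall>\<^sub>F n in sequentially. (x \<circ> r) n \<in> T"
      using W\<^sub>0(2) by (intro topological_tendstoD[OF z(3)]) auto
    then obtain N where "\<And>n. n \<ge> N \<Longrightarrow> x (r n) \<in> W\<^sub>0"
      using T(2) xM by (auto simp: eventually_sequentially)
    \<comment> \<open>Two consecutive late terms of the convergent subsequence give a
      return.\<close>
    then have "x (r N) \<in> W\<^sub>0" "x (r (Suc N)) \<in> W\<^sub>0"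
      by auto
    moreover have "r N < r (Suc N)"
      using z(2) by (simp add: strict_monoD)
    ultimately have "returns (r (Suc N) - r N)"
      unfolding returns_def by (intro conjI exI[of _ "r N"]) auto
    then show ?thesis ..
  qed
  \<comment> \<open>The shortest return time is taken because its minimality forces the cycle points
    to be distinct.\<close>
  define k where "k = (LEAST n. returns n)"
  have "returns k"
    unfolding k_def using \<open>\<exists>n. returns n\<close> by (rule LeastI_ex)
  then obtain i where "k > 0" and i: "x i \<in> W\<^sub>0" "x (i + k) \<in> W\<^sub>0"
    unfolding returns_def by blast
  define p where "p l = x (i + l)" for l
  have pM: "p l \<in> M" for l
    by (simp add: p_def xM)
  have fp: "f (p l) = p (Suc l)" for l
    by (simp add: p_def x_def)
  text \<open>A repetition among the \<open>p l\<close> could be cut out of the orbit, giving a shorter return.\<close>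
  have p_less: "p l \<noteq> p l'" if "l < l'" "l' < k" for l l'
  proof
    assume eq: "p l = p l'"
    have shift: "(f ^^ n) (p m) = p (n + m)" for n m
      by (induction n) (simp_all add: fp)
    \<comment> \<open>Applying \<open>f\<close> another \<open>k - l'\<close> times leads from
      \<open>p l'\<close> to \<open>p k\<close>, which is in \<open>W\<^sub>0\<close>; from
      \<open>p l\<close> it leads there after fewer than \<open>k\<close> steps in all.\<close>
    have "p (k - l' + l) = p (k - l' + l')"
      using eq shift by metis
    then have "x (i + (k - l' + l)) \<in> W\<^sub>0"
      using i(2) that by (simp add: p_def)
    then have "returns (k - l' + l)"
      unfolding returns_def using i(1) that by auto
    moreover have "k - l' + l < k"
      using that by simp
    ultimately show False
      unfolding k_def using not_less_Least by blast
  qed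
  then have p_inj: "p l \<noteq> p l'" if "l \<noteq> l'" "l < k" "l' < k" for l l'
    using that by (metis nat_neq_iff)

  \<comment> \<open>Neighbourhoods along the cycle\<close>
  have "\<exists>W. openin (top_of_set M) W \<and> p l \<in> W \<and> W \<subseteq> ball (p l) \<eta> \<and> blendable W" for l
    using chart[OF pM \<open>\<eta> > 0\<close>] by metis
  then obtain W' where W': "\<And>l. openin (top_of_set M) (W' l)" "\<And>l. p l \<in> W' l"
      "\<And>l. W' l \<subseteq> ball (p l) \<eta>" "\<And>l. blendable (W' l)"
    by metis
  \<comment> \<open>Index 0 uses \<open>W\<^sub>0\<close>, which contains both \<open>p 0\<close>
    and \<open>p k\<close> and so absorbs the closing error; it lies in a ball around
    \<open>z\<close>, whence the separate centres \<open>c l\<close>.\<close>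
  define W where "W l = (if l = 0 then W\<^sub>0 else W' l)" for l
  define c where "c l = (if l = 0 then z else p l)" for l
  have W: "openin (top_of_set M) (W l)" "p l \<in> W l" "W l \<subseteq> ball (c l) \<eta>" "blendable (W l)" for l
    using W\<^sub>0 W' i(1) by (auto simp: W_def c_def p_def)
  \<comment> \<open>The target neighbourhood of step \<open>l\<close>; the index wraps around, so
    the last step aims at \<open>W\<^sub>0\<close>.\<close>
  define V where "V l = W (Suc l mod k)" for l
  have fpV: "f (p l) \<in> V l" if "l < k" for l
  proof (cases "Suc l = k")
    case True
    then show ?thesis using i(2) fp[of l] by (simp add: V_def W_def p_def)
  next
    case False
    then show ?thesis using that W(2) fp[of l] by (simp add: V_def)
  qed
  \<comment> \<open>The inclusion in \<open>W l\<close> makes the arc near \<open>p l\<close> an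
    admissible target; the one in the preimage keeps \<open>f\<close> within \<open>V l\<close>,
    where blending is possible.\<close>
  have "\<forall>\<^sub>F \<rho> in at_right 0. M \<inter> cball (p l) \<rho> \<subseteq> W l \<inter> (M \<inter> f -` V l)" if "l < k" for l
  proof (rule eventually_cball_subset_openin)
    have "openin (top_of_set M) (M \<inter> f -` V l)"
      using continuous_openin_preimage[OF contf, of M "V l"] fM W(1)
      by (simp add: V_def image_subset_iff_funcset)
    then show "openin (top_of_set M) (W l \<inter> (M \<inter> f -` V l))"
      by (rule openin_Int[OF W(1)])
    show "p l \<in> W l \<inter> (M \<inter> f -` V l)"
      using W(2) fpV[OF that] pM by blast
  qed
  then have "\<forall>\<^sub>F \<rho> in at_right 0. \<forall>l\<in>{..<k}. M \<inter> cball (p l) \<rho> \<subseteq> W l \<inter> (M \<inter> f -` V l)"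
    by (intro eventually_ball_finite ballI) simp_all
  moreover have "\<forall>\<^sub>F \<rho> in at_right 0. \<forall>l\<in>{..<k}. \<forall>l'\<in>{..<k} - {l}. cball (p l) \<rho> \<inter> cball (p l') \<rho> = {}"
    by (intro eventually_ball_finite ballI eventually_disjoint_cballs p_inj) auto
  ultimately have "\<forall>\<^sub>F \<rho> in at_right 0. \<rho> > 0 \<and>
      (\<forall>l<k. M \<inter> cball (p l) \<rho> \<subseteq> W l \<inter> (M \<inter> f -` V l)) \<and>
      (\<forall>l l'. l < k \<and> l' < k \<and> l \<noteq> l' \<longrightarrow> cball (p l) \<rho> \<inter> cball (p l') \<rho> = {})"
    using eventually_at_right_less[of "0::real"] by eventually_elim blast
  from eventually_happens'[OF trivial_limit_at_right_real this] obtain \<rho> :: real where "\<rho> > 0"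
    and \<rho>WV: "\<forall>l<k. M \<inter> cball (p l) \<rho> \<subseteq> W l \<inter> (M \<inter> f -` V l)"
    and "\<forall>l l'. l < k \<and> l' < k \<and> l \<noteq> l' \<longrightarrow> cball (p l) \<rho> \<inter> cball (p l') \<rho> = {}"
    by (elim exE conjE) (rule that)
  then have disj: "\<And>l l'. \<lbrakk>l < k; l' < k; l \<noteq> l'\<rbrakk> \<Longrightarrow> cball (p l) \<rho> \<inter> cball (p l') \<rho> = {}"
    by blast
  have \<rho>W: "M \<inter> cball (p l) \<rho> \<subseteq> W l" and \<rho>V: "f ` (M \<inter> cball (p l) \<rho>) \<subseteq> V l" if "l < k" for l
    using \<rho>WV that by blast+

  \<comment> \<open>The arcs and the perturbed map\<close>
  have "\<exists>\<alpha>. continuous_on {0..1::real} \<alpha> \<and> inj_on \<alpha> {0..1} \<and> \<alpha> ` {0..1} \<subseteq> M \<inter> cball (p l) (\<rho> / 2)"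
    for l
  proof -
    have "\<rho> / 2 > 0"
      using \<open>\<rho> > 0\<close> by simp
    then obtain U \<alpha> where "openin (top_of_set M) U" "U \<subseteq> ball (p l) (\<rho> / 2)"
        "continuous_on {0..1::real} \<alpha>" "inj_on \<alpha> {0..1}" "\<alpha> ` {0..1} \<subseteq> U"
      using chart[OF pM] by metis
    then show ?thesis
      using openin_imp_subset ball_subset_cball by (metis le_inf_iff order_trans)
  qed
  then obtain \<alpha> where \<alpha>: "\<And>l. continuous_on {0..1::real} (\<alpha> l)" "\<And>l. inj_on (\<alpha> l) {0..1}"
      "\<And>l. \<alpha> l ` {0..1} \<subseteq> M \<inter> cball (p l) (\<rho> / 2)"
    by metis
  have \<alpha>W: "\<alpha> l t \<in> W l" if "l < k" "t \<in> {0..1}" for l t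
  proof -
    have "\<alpha> l t \<in> M \<inter> cball (p l) (\<rho> / 2)"
      using \<alpha>(3) that(2) by blast
    then have "\<alpha> l t \<in> M \<inter> cball (p l) \<rho>"
      using \<open>\<rho> > 0\<close> by auto
    then show ?thesis
      using \<rho>W that(1) by blast
  qed
  \<comment> \<open>Only the step closing the cycle applies \<open>zigzag\<close>; for
    \<open>k = 1\<close> this is the only step.\<close>
  define \<beta> where "\<beta> l = (if Suc l = k then \<lambda>t. \<alpha> 0 (zigzag t) else \<alpha> (Suc l))" for l
  have cont\<beta>: "continuous_on {0..1} (\<beta> l)" for l
    using \<alpha>(1) zigzag_in_unit
    by (auto simp: \<beta>_def image_subset_iff
        intro!: continuous_on_compose2[OF \<alpha>(1)] continuous_on_zigzag)
  have \<beta>V: "\<beta> l ` {0..1} \<subseteq> V l" if "l < k" for l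
    using that \<alpha>W[of 0] \<alpha>W[of "Suc l"] zigzag_in_unit \<open>k > 0\<close>
    by (cases "Suc l = k") (simp_all add: \<beta>_def V_def image_subset_iff)
  have V: "blendable (V l)" "V l \<subseteq> M" for l
    using W(4) openin_imp_subset[OF W(1)] by (auto simp: V_def)
  obtain g where g: "g \<in> Cmaps M"
    and g\<alpha>: "\<And>l t. \<lbrakk>l < k; t \<in> {0..1}\<rbrakk> \<Longrightarrow> g (\<alpha> l t) = \<beta> l t"
    and gf: "\<And>x. x \<in> M \<Longrightarrow> g x = f x \<or> (\<exists>l<k. x \<in> cball (p l) \<rho> \<and> g x \<in> V l)"
  proof -
    have "\<exists>g\<in>Cmaps M. (\<forall>l<k. \<forall>t\<in>{0..1}. g (\<alpha> l t) = \<beta> l t) \<and>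
      (\<forall>x\<in>M. g x = f x \<or> (\<exists>l<k. x \<in> cball (p l) \<rho> \<and> g x \<in> V l))"
      by (rule redirect_arcs[OF f \<open>\<rho> > 0\<close>]; rule disj V \<rho>V \<alpha> cont\<beta> \<beta>V; assumption)
    then show ?thesis
      using that by metis
  qed

  \<comment> \<open>Chaos of the perturbed map and its distance to the original\<close>
  have "exhibits_DC1 M g"
  proof (rule exhibits_DC1_arc_cycle)
    show "g (\<alpha> l t) = \<alpha> (Suc l) t" if "Suc l < k" "t \<in> {0..1}" for l t
      using that g\<alpha>[of l t] by (simp add: \<beta>_def)
    show "g (\<alpha> l t) = \<alpha> 0 (zigzag t)" if "Suc l = k" "t \<in> {0..1}" for l t
      using that g\<alpha>[of l t] by (auto simp: \<beta>_def)
    show "\<alpha> 0 ` {0..1} \<subseteq> M"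
      using \<alpha>(3) by blast
  qed (use \<alpha> \<open>k > 0\<close> in auto)
  \<comment> \<open>If \<open>y\<close> is affected, \<open>f y\<close> and \<open>g y\<close> lie
    in the same \<open>V l\<close>, hence within \<open>\<eta>\<close> of the common centre
    \<open>c m\<close>.\<close>
  moreover have "dist (f y) (g y) \<le> 2 * \<eta>" if y: "y \<in> M" for y
  proof (cases "g y = f y")
    case True
    then show ?thesis using \<open>\<eta> > 0\<close> by simp
  next
    case False
    then obtain l where "l < k" "y \<in> cball (p l) \<rho>" "g y \<in> V l"
      using gf[OF y] by blast
    moreover from this have "f y \<in> V l"
      using \<rho>V y by blast
    moreover define m where "m = Suc l mod k"
    ultimately have "dist (c m) (g y) < \<eta>" "dist (c m) (f y) < \<eta>"
      using W(3)[of m] by (auto simp: V_def m_def subset_iff)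
    then show ?thesis
      using dist_triangle3[of "f y" "g y" "c m"] by linarith
  qed
  then have "(SUP y\<in>M. dist (f y) (g y)) \<le> 2 * \<eta>"
    by (rule cSUP_least[OF \<open>M \<noteq> {}\<close>])
  then have "(SUP y\<in>M. dist (f y) (g y)) < \<epsilon>"
    using \<open>\<epsilon> > 0\<close> by (simp add: \<eta>_def)
  ultimately show "\<exists>g\<in>Cmaps M. exhibits_DC1 M g \<and> (SUP x\<in>M. dist (f x) (g x)) < \<epsilon>"
    using g by blast
qed

end
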